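(* Let $\phi=\frac{1+\sqrt5}{2}$. Then $$\operatorname{Li}_2\left(\frac{\sqrt{\phi^7+3\phi^5}-\phi^2-3\phi}{2}\right)-\operatorname{Li}_2\left(\frac{1+\sqrt{4\phi-3}}{2\phi}\right)=-\frac{\pi^2}{10}+\ln^2(\phi)-\ln\left(\frac{\phi^2+1+\sqrt{4\phi^3-3\phi^2}}{2}\right)\ln\left(\frac{2\phi-1+\sqrt{4\phi-3}}{2\phi}\right).$$
   Context: $\operatorname{Li}_2(z)=\sum_{k\ge1}z^k/k^2$ for $|z|\le 1$ is the dilogarithm; $\ln$ is the natural logarithm and $\ln^2(y)=(\ln y)^2$. *)

theory Defs
  imports "HOL-Analysis.Analysis"
begin

(* The series converges exactly for norm z <= 1, which is the intended domain. For other
   arguments suminf is unspecified; there is no analytic continuation. *)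
definition Li2 :: "'a::{real_normed_field,banach} \<Rightarrow> 'a" where
  "Li2 z = (\<Sum>k. z ^ Suc k / of_nat (Suc k) ^ 2)"

lemma summable_Li2:
  fixes z :: "'a::{real_normed_field,banach}"
  assumes "norm z \<le> 1"
  shows "summable (\<lambda>k. z ^ Suc k / of_nat (Suc k) ^ 2)"
proof (rule summable_comparison_test')
  show "summable (\<lambda>k. 1 / real (Suc k) ^ 2)"
    using inverse_squares_sums by (simp add: sums_iff add.commute)
  show "norm (z ^ Suc k / of_nat (Suc k) ^ 2) \<le> 1 / real (Suc k) ^ 2" if "k \<ge> 0" for k
    using assms power_le_one[of "norm z" "Suc k"]
    by (simp add: norm_divide norm_power norm_mult divide_right_mono del: of_nat_Suc)
qed

end

theory Submission
  imports Defs "HOL-Real_Asymp.Real_Asymp"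
begin

text \<open>
  Write \<open>u\<close> and \<open>w\<close> for the second and the first argument of \<open>Li2\<close> in the theorem. Both are exceptional
  units: \<open>w\<close>, \<open>1 - u\<close> and \<open>1 - w\<close> are monomials in \<open>\<phi>\<close> and \<open>u\<close>. Abel's five-term relation at
  \<open>(1 - w, u)\<close> has the remaining arguments \<open>v = 1 / (\<phi> u)\<close>, \<open>1 - v\<close> and \<open>1 / \<phi>\<close>, so that reflection
  eliminates \<open>v\<close> and the value of \<open>Li2 (1 / \<phi>)\<close> finishes the proof. That value follows in turn from the
  five-term relation at \<open>(1 / \<phi>, 1 / \<phi>)\<close> together with reflection.
\<close>

section \<open>Continuity and derivative of the real dilogarithm\<close>

lemma Li2_0 [simp]: "Li2 0 = 0"
  by (simp add: Li2_def)

lemma Li2_1: "Li2 (1::real) = pi\<^sup>2 / 6"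
  using inverse_squares_sums by (simp add: Li2_def sums_iff add.commute)

text \<open>Domination by the inverse squares makes the series converge uniformly on the closed
  interval. Continuity thus reaches the endpoint 1, where the reflection formula needs a
  limit.\<close>

lemma continuous_on_Li2: "continuous_on {-1..1} (Li2 :: real \<Rightarrow> real)"
proof -
  have "uniform_limit {-1..1} (\<lambda>n x. \<Sum>k<n. x ^ Suc k / real (Suc k) ^ 2)
          (\<lambda>x. \<Sum>k. x ^ Suc k / real (Suc k) ^ 2) sequentially"
  proof (rule Weierstrass_m_test)
    fix k and x :: real
    assume "x \<in> {-1..1}"
    then have "\<bar>x\<bar> ^ Suc k \<le> 1"
      by (intro power_le_one) auto
    then show "norm (x ^ Suc k / real (Suc k) ^ 2) \<le> 1 / real (Suc k) ^ 2"
      by (simp add: norm_divide norm_power divide_right_mono abs_mult power_abs del: of_nat_Suc)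
  qed (use inverse_squares_sums in \<open>simp add: sums_iff add.commute\<close>)
  then show ?thesis
    unfolding Li2_def
    by (rule uniform_limit_theorem[rotated]) (auto intro!: always_eventually continuous_intros simp del: of_nat_Suc)
qed

text \<open>Differentiating the power series termwise leaves the sum of
  \<open>x ^ n / Suc n\<close>, which is the logarithm series divided by \<open>x\<close>.\<close>

lemma DERIV_Li2:
  fixes x :: real
  assumes "0 < x" "x < 1"
  shows "(Li2 has_real_derivative - ln (1 - x) / x) (at x)"
proof -
  \<comment> \<open>\<open>c 0 = 0\<close> because division by zero yields zero.\<close>
  define c where "c = (\<lambda>n. 1 / (real n)\<^sup>2)"
  have summ: "summable (\<lambda>n. c n * y ^ n)" if "\<bar>y\<bar> \<le> 1" for y
    using summable_Li2[of y] that
    by (subst summable_Suc_iff[symmetric]) (simp add: c_def)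
  have Li2_c: "Li2 y = (\<Sum>n. c n * y ^ n)" if "\<bar>y\<bar> \<le> 1" for y
    using suminf_split_head[OF summ[OF that]] by (simp add: Li2_def c_def)
  have "((\<lambda>y. \<Sum>n. c n * y ^ n) has_real_derivative (\<Sum>n. diffs c n * x ^ n)) (at x)"
    using assms by (intro termdiffs_strong[of c 1] summ) auto
  moreover have "(\<Sum>n. diffs c n * x ^ n) = - ln (1 - x) / x"
  proof -
    have coeff: "diffs c n * x ^ n = x ^ n / real (Suc n)" for n
      by (simp add: diffs_def c_def power2_eq_square del: of_nat_Suc)
    \<comment> \<open>\<open>ln_series\<close> expands around 1, so at \<open>1 - x\<close> it
      yields powers of \<open>1 - x - 1\<close>, whose signs cancel the alternating ones.\<close>
    have term_eq: "(-1) ^ n * (1 / real (n + 1)) * (1 - x - 1) ^ Suc n = - (x * (diffs c n * x ^ n))" for n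
    proof -
      have "(-1) ^ n * (-1) ^ n = (1::real)"
        by (simp flip: power_mult_distrib)
      then have "(-1) ^ n * (1 - x - 1) ^ Suc n = - (x ^ Suc n)"
        by (simp add: power_minus[of x])
      then show ?thesis
        unfolding coeff by (simp add: field_simps)
    qed
    have "summable (\<lambda>n. diffs c n * x ^ n)"
      using assms by (intro termdiff_converges[of _ 1] summ) auto
    then have "ln (1 - x) = - (x * (\<Sum>n. diffs c n * x ^ n))"
      using ln_series[of "1 - x"] assms
      unfolding term_eq by (simp add: suminf_minus suminf_mult summable_mult)
    then show ?thesis
      using assms by (simp add: field_simps)
  qed
  ultimately have "((\<lambda>y. \<Sum>n. c n * y ^ n) has_real_derivative - ln (1 - x) / x) (at x)"
    by simp
  \<comment> \<open>\<open>Li2_c\<close> is restricted to the closed unit interval around 0, so the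
    derivative is transferred through local agreement near \<open>x\<close>.\<close>
  moreover have ev: "\<forall>\<^sub>F y in nhds x. (\<Sum>n. c n * y ^ n) = Li2 y"
    using eventually_nhds_in_open[of "{0<..<1}" x] assms
    by (auto simp: Li2_c elim!: eventually_mono)
  ultimately show ?thesis
    using DERIV_cong_ev[OF refl ev refl] by simp
qed

lemma DERIV_Li2_chain [derivative_intros]:
  fixes g :: "real \<Rightarrow> real"
  assumes "(g has_real_derivative d) (at x)" "0 < g x" "g x < 1"
  shows "((\<lambda>x. Li2 (g x)) has_real_derivative - ln (1 - g x) / g x * d) (at x)"
  using DERIV_chain2[OF DERIV_Li2 assms(1)] assms(2,3) by blast

lemma continuous_on_Li2_comp [continuous_intros]:
  fixes g :: "'a::topological_space \<Rightarrow> real"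
  assumes "continuous_on A g" "\<And>x. x \<in> A \<Longrightarrow> -1 \<le> g x" "\<And>x. x \<in> A \<Longrightarrow> g x \<le> 1"
  shows "continuous_on A (\<lambda>x. Li2 (g x))"
  using assms by (intro continuous_on_compose2[OF continuous_on_Li2]) auto

section \<open>Functional equations: reflection and the five-term relation\<close>

lemma Li2_reflection:
  fixes x :: real
  assumes "0 < x" "x < 1"
  shows "Li2 x + Li2 (1 - x) = pi\<^sup>2 / 6 - ln x * ln (1 - x)"
proof -
  \<comment> \<open>The derivative of the logarithm product cancels those of the dilogarithms, so
    \<open>F\<close> is constant on the open interval. Its value is the right limit at 0, where the
    product tends to 0 and \<open>Li2 (1 - t)\<close> to \<open>Li2 1\<close>.\<close>
  define F where "F = (\<lambda>t::real. Li2 t + Li2 (1 - t) + ln t * ln (1 - t))"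
  have "(F has_real_derivative 0) (at t)" if "0 < t" "t < 1" for t
    unfolding F_def using that
    by (auto intro!: derivative_eq_intros simp: divide_simps)
  then have const: "F t = F x" if "0 < t" "t < 1" for t
    using DERIV_isconst3[of 0 1 t x F] that assms by auto
  have "((\<lambda>t::real. Li2 t + Li2 (1 - t)) \<longlongrightarrow> Li2 0 + Li2 (1 - 0)) (at_right 0)"
  proof -
    have "continuous_on {0..1} (\<lambda>t::real. Li2 t + Li2 (1 - t))"
      by (intro continuous_intros) auto
    then have "((\<lambda>t::real. Li2 t + Li2 (1 - t)) \<longlongrightarrow> Li2 0 + Li2 (1 - 0)) (at 0 within {0..1})"
      unfolding continuous_on_def by (rule bspec) simp
    then show ?thesis
      by (simp add: at_within_Icc_at_right)
  qed
  moreover have "((\<lambda>t::real. ln t * ln (1 - t)) \<longlongrightarrow> 0) (at_right 0)"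
    by real_asymp
  ultimately have "(F \<longlongrightarrow> pi\<^sup>2 / 6) (at_right 0)"
    unfolding F_def using tendsto_add by (fastforce simp: Li2_1)
  moreover have "\<forall>\<^sub>F t in at_right 0. F t = F x"
    using const by (auto simp: eventually_at_right_field intro!: exI[of _ 1])
  then have "(F \<longlongrightarrow> F x) (at_right 0)"
    by (rule tendsto_eventually)
  ultimately have "F x = pi\<^sup>2 / 6"
    by (rule tendsto_unique[OF trivial_limit_at_right_real, rotated])
  then show ?thesis
    by (simp add: F_def)
qed

text \<open>Fix \<open>y\<close> and let the first variable \<open>t\<close> run: the difference
  \<open>F\<close> of the two sides has derivative zero and vanishes at \<open>t = 0\<close>, where
  the two terms that tend to \<open>Li2 y\<close> cancel.\<close>

lemma Li2_five_term:
  fixes x y :: real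
  assumes "0 < x" "x < 1" "0 < y" "y < 1"
  shows "Li2 x + Li2 y - Li2 (x * y) - Li2 (x * (1 - y) / (1 - x * y)) - Li2 (y * (1 - x) / (1 - x * y))
       = ln ((1 - x) / (1 - x * y)) * ln ((1 - y) / (1 - x * y))"
proof -
  define F where "F = (\<lambda>t. Li2 t + Li2 y - Li2 (t * y) - Li2 (t * (1 - y) / (1 - t * y))
    - Li2 (y * (1 - t) / (1 - t * y)) - (ln (1 - t) - ln (1 - t * y)) * (ln (1 - y) - ln (1 - t * y)))"
  have ty: "t * y < 1" if "t < 1" for t
    using mult_strict_right_mono[OF that \<open>0 < y\<close>] \<open>y < 1\<close> by linarith
  have a1: "1 - t * (1 - y) / (1 - t * y) = (1 - t) / (1 - t * y)"
    and b1: "1 - y * (1 - t) / (1 - t * y) = (1 - y) / (1 - t * y)" if "t < 1" for t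
    using ty[OF that] by (simp_all add: diff_divide_eq_iff algebra_simps)
  have a2: "t * (1 - y) / (1 - t * y) < 1" and b2: "y * (1 - t) / (1 - t * y) < 1" if "t < 1" for t
    using ty[OF that] that \<open>y < 1\<close> by (simp_all add: divide_less_eq algebra_simps)
  \<comment> \<open>At \<open>t = 0\<close> some arguments of \<open>Li2\<close> are 0, where
    \<open>DERIV_Li2\<close> does not apply; continuity there links the interior to the value
    \<open>F 0\<close>.\<close>
  have "continuous_on {0..x} F"
  proof -
    have *: "1 - t * y \<noteq> 0" "0 < 1 - t * y" "-1 \<le> t" "t \<le> 1" "-1 \<le> t * y" "t * y \<le> 1"
      "-1 \<le> t * (1 - y) / (1 - t * y)" "t * (1 - y) / (1 - t * y) \<le> 1"
      "-1 \<le> y * (1 - t) / (1 - t * y)" "y * (1 - t) / (1 - t * y) \<le> 1"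
      if "t \<in> {0..x}" for t
    proof -
      have t: "0 \<le> t" "t < 1" "t * y < 1" "0 \<le> t * y"
        using that assms ty[of t] by auto
      then have "0 \<le> t * (1 - y) / (1 - t * y)" "0 \<le> y * (1 - t) / (1 - t * y)"
        using assms by auto
      with t a2[of t] b2[of t]
      show "1 - t * y \<noteq> 0" "0 < 1 - t * y" "-1 \<le> t" "t \<le> 1" "-1 \<le> t * y" "t * y \<le> 1"
        "-1 \<le> t * (1 - y) / (1 - t * y)" "t * (1 - y) / (1 - t * y) \<le> 1"
        "-1 \<le> y * (1 - t) / (1 - t * y)" "y * (1 - t) / (1 - t * y) \<le> 1"
        by linarith+
    qed
    show ?thesis
      unfolding F_def
      by (intro continuous_intros) ((rule *; assumption) | (use assms * in force))+
  qed
  moreover have "(F has_real_derivative 0) (at t)" if "0 < t" "t < x" for t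
  proof -
    have t: "t < 1" "t * y < 1" "0 < t * y"
      using that assms ty[of t] by auto
    have pos: "0 < t * (1 - y) / (1 - t * y)" "0 < y * (1 - t) / (1 - t * y)"
      using t that assms by auto
    \<comment> \<open>By \<open>a1\<close> and \<open>b1\<close>, \<open>X\<close> and
      \<open>Y\<close> are the logarithms of the complements of the two quotient arguments; their
      product is the logarithmic term of \<open>F\<close>.\<close>
    define X where "X = ln (1 - t) - ln (1 - t * y)"
    define Y where "Y = ln (1 - y) - ln (1 - t * y)"
    have dA: "((\<lambda>t. Li2 (t * (1 - y) / (1 - t * y))) has_real_derivative - X / (t * (1 - t * y))) (at t)"
    proof -
      have dg: "((\<lambda>t. t * (1 - y) / (1 - t * y)) has_real_derivative (1 - y) / (1 - t * y)\<^sup>2) (at t)"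
        by (rule derivative_eq_intros refl | use t in force)+
           (use t in \<open>simp add: power2_eq_square algebra_simps\<close>)
      have l: "ln (1 - t * (1 - y) / (1 - t * y)) = X"
        using t unfolding a1[OF t(1)] X_def by (simp add: ln_div)
      have e: "- X / (t * (1 - y) / (1 - t * y)) * ((1 - y) / (1 - t * y)\<^sup>2) = - X / (t * (1 - t * y))"
        using t that assms by (simp add: power2_eq_square)
      show ?thesis
        using DERIV_Li2_chain[OF dg pos(1) a2[OF t(1)]] unfolding l e .
    qed
    have dB: "((\<lambda>t. Li2 (y * (1 - t) / (1 - t * y))) has_real_derivative
        Y * (1 - y) / ((1 - t) * (1 - t * y))) (at t)"
    proof -
      have dg: "((\<lambda>t. y * (1 - t) / (1 - t * y)) has_real_derivative - (y * (1 - y)) / (1 - t * y)\<^sup>2) (at t)"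
        by (rule derivative_eq_intros refl | use t in force)+
           (use t in \<open>simp add: power2_eq_square algebra_simps\<close>)
      have l: "ln (1 - y * (1 - t) / (1 - t * y)) = Y"
        using t assms unfolding b1[OF t(1)] Y_def by (simp add: ln_div)
      have e: "- Y / (y * (1 - t) / (1 - t * y)) * (- (y * (1 - y)) / (1 - t * y)\<^sup>2)
          = Y * (1 - y) / ((1 - t) * (1 - t * y))"
        using t assms by (simp add: power2_eq_square)
      show ?thesis
        using DERIV_Li2_chain[OF dg pos(2) b2[OF t(1)]] unfolding l e .
    qed
    have dC: "((\<lambda>t. Li2 (t * y)) has_real_derivative - ln (1 - t * y) / t) (at t)"
    proof -
      have "((\<lambda>t. t * y) has_real_derivative y) (at t)"
        by (auto intro!: derivative_eq_intros)
      from DERIV_Li2_chain[OF this t(3,2)] show ?thesis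
        using assms by simp
    qed
    have dD: "((\<lambda>t. ln (1 - t * y)) has_real_derivative - y / (1 - t * y)) (at t)"
      using t by (auto intro!: derivative_eq_intros)
    have dE: "((\<lambda>t. ln (1 - t)) has_real_derivative - 1 / (1 - t)) (at t)"
      using t by (auto intro!: derivative_eq_intros)
    have "(F has_real_derivative
        - ln (1 - t) / t + 0 - - ln (1 - t * y) / t - - X / (t * (1 - t * y))
        - Y * (1 - y) / ((1 - t) * (1 - t * y))
        - ((- 1 / (1 - t) - - y / (1 - t * y)) * (ln (1 - y) - ln (1 - t * y))
            + (0 - - y / (1 - t * y)) * (ln (1 - t) - ln (1 - t * y)))) (at t)"
      unfolding F_def
      by (intro DERIV_diff DERIV_add DERIV_mult DERIV_const DERIV_Li2[OF that(1) t(1)] dA dB dC dD dE)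
    \<comment> \<open>All logarithms combine into \<open>X\<close> and \<open>Y\<close>, and their
      rational coefficients vanish separately.\<close>
    also have "- ln (1 - t) / t + 0 - - ln (1 - t * y) / t - - X / (t * (1 - t * y))
        - Y * (1 - y) / ((1 - t) * (1 - t * y))
        - ((- 1 / (1 - t) - - y / (1 - t * y)) * (ln (1 - y) - ln (1 - t * y))
            + (0 - - y / (1 - t * y)) * (ln (1 - t) - ln (1 - t * y)))
      = X * (- 1 / t + 1 / (t * (1 - t * y)) - y / (1 - t * y))
        + Y * (- (1 - y) / ((1 - t) * (1 - t * y)) + 1 / (1 - t) - y / (1 - t * y))"
      unfolding X_def Y_def by (simp add: ring_distribs diff_divide_distrib mult.commute)
    also have "- 1 / t + 1 / (t * (1 - t * y)) - y / (1 - t * y) = 0"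
      using t that by (simp add: divide_simps)
    also have "- (1 - y) / ((1 - t) * (1 - t * y)) + 1 / (1 - t) - y / (1 - t * y) = 0"
    proof -
      have "1 / (1 - t) = (1 - t * y) / ((1 - t) * (1 - t * y))"
        and "y / (1 - t * y) = y * (1 - t) / ((1 - t) * (1 - t * y))"
        using t by auto
      then show ?thesis
        by (simp add: algebra_simps flip: add_divide_distrib diff_divide_distrib)
    qed
    finally show ?thesis
      by simp
  qed
  ultimately have "F x = F 0"
    using DERIV_isconst_end[of 0 x F] \<open>0 < x\<close> by blast
  also have "F 0 = 0"
    by (simp add: F_def)
  finally have "F x = 0" .
  moreover have "ln ((1 - x) / (1 - x * y)) = ln (1 - x) - ln (1 - x * y)"
    and "ln ((1 - y) / (1 - x * y)) = ln (1 - y) - ln (1 - x * y)"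
    using assms ty[of x] by (simp_all add: ln_div)
  ultimately show ?thesis
    unfolding F_def by (simp only: diff_eq_eq add_0)
qed

section \<open>Evaluation at the golden ratio\<close>

lemma golden_ratio:
  fixes \<phi> :: real
  assumes "\<phi> = (1 + sqrt 5) / 2"
  shows golden_ratio_gt_1: "\<phi> > 1" and golden_ratio_sq: "\<phi>\<^sup>2 = \<phi> + 1"
proof -
  have "sqrt 5 > 1"
    by simp
  then show "\<phi> > 1"
    unfolding assms by simp
  show "\<phi>\<^sup>2 = \<phi> + 1"
    by (simp add: assms power_divide power2_sum)
qed

lemma Li2_golden:
  fixes \<phi> :: real
  assumes "\<phi> = (1 + sqrt 5) / 2"
  shows "Li2 (1 / \<phi>) = pi\<^sup>2 / 10 - (ln \<phi>)\<^sup>2"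
proof -
  note pos = golden_ratio_gt_1[OF assms] and sq = golden_ratio_sq[OF assms]
  have eq: "1 - 1 / \<phi> = 1 / \<phi>\<^sup>2" "1 - 1 / \<phi>\<^sup>2 = 1 / \<phi>"
    using pos sq by (auto simp: field_simps power2_eq_square)
  have "Li2 (1 / \<phi>) + Li2 (1 / \<phi>\<^sup>2) = pi\<^sup>2 / 6 - 2 * (ln \<phi>)\<^sup>2"
    using Li2_reflection[of "1 / \<phi>"] pos ln_realpow[of \<phi> 2]
    by (simp add: eq ln_div power2_eq_square[of "ln \<phi>"])
  \<comment> \<open>At \<open>x = y = 1 / \<phi>\<close> the product and both quotients equal the
    inverse square of \<phi>. This is a second linear equation, independent of the one from
    reflection, for the same two values.\<close>
  moreover have "2 * Li2 (1 / \<phi>) - 3 * Li2 (1 / \<phi>\<^sup>2) = (ln \<phi>)\<^sup>2"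
  proof -
    have xy: "1 / \<phi> * (1 / \<phi>) = 1 / \<phi>\<^sup>2"
      by (simp add: power2_eq_square)
    have r: "1 / \<phi> * (1 / \<phi>\<^sup>2) / (1 / \<phi>) = 1 / \<phi>\<^sup>2" "1 / \<phi>\<^sup>2 / (1 / \<phi>) = 1 / \<phi>"
      using pos by (auto simp: power2_eq_square)
    show ?thesis
      using Li2_five_term[of "1 / \<phi>" "1 / \<phi>"] pos unfolding xy eq r
      by (simp add: ln_div power2_eq_square)
  qed
  ultimately show ?thesis
    by (simp add: field_simps)
qed

theorem theorem12:
  fixes \<phi> :: real
  assumes "\<phi> = (1 + sqrt 5) / 2"
  shows "Li2 ((sqrt (\<phi> ^ 7 + 3 * \<phi> ^ 5) - \<phi> ^ 2 - 3 * \<phi>) / 2)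
           - Li2 ((1 + sqrt (4 * \<phi> - 3)) / (2 * \<phi>))
       = - (pi ^ 2 / 10) + (ln \<phi>) ^ 2
           - ln ((\<phi> ^ 2 + 1 + sqrt (4 * \<phi> ^ 3 - 3 * \<phi> ^ 2)) / 2)
             * ln ((2 * \<phi> - 1 + sqrt (4 * \<phi> - 3)) / (2 * \<phi>))"
proof -
  define s where "s = sqrt (4 * \<phi> - 3)"
  define u where "u = (1 + s) / (2 * \<phi>)"
  note pos = golden_ratio_gt_1[OF assms] and sq = golden_ratio_sq[OF assms]
  have s: "s\<^sup>2 = 4 * \<phi> - 3" "s > 0"
    using pos by (auto simp: s_def)
  have u0: "u > 0" and us: "2 * \<phi> * u = 1 + s"
    using pos s by (auto simp: u_def)
  \<comment> \<open>This quadratic equation for \<open>u\<close> and that for \<phi> underlie the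
    monomial identities below.\<close>
  have u_eq: "\<phi> ^ 3 * u\<^sup>2 = \<phi>\<^sup>2 * u + 1"
    using sq s(1) us by algebra
  define v w where "v = 1 / (\<phi> * u)" and "w = 1 / (\<phi> ^ 4 * u ^ 3)"
  have compl: "1 - u = 1 / (\<phi> ^ 5 * u\<^sup>2)" "1 - v = 1 / (\<phi> ^ 3 * u\<^sup>2)" "1 - w = 1 / (\<phi> * u\<^sup>2)"
  proof -
    have "(1 - u) * (\<phi> ^ 5 * u\<^sup>2) = 1"
      using u_eq sq by algebra
    then show "1 - u = 1 / (\<phi> ^ 5 * u\<^sup>2)"
      using pos u0 by (simp add: eq_divide_eq)
    show "1 - v = 1 / (\<phi> ^ 3 * u\<^sup>2)"
      using pos u0 u_eq by (simp add: v_def divide_simps) algebra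
    have "\<phi> ^ 4 * u ^ 3 - 1 = \<phi> ^ 3 * u"
      using u_eq sq by algebra
    then have "1 - w = \<phi> ^ 3 * u / (\<phi> ^ 4 * u ^ 3)"
      using pos u0 by (simp add: w_def divide_simps)
    also have "\<dots> = 1 / (\<phi> * u\<^sup>2)"
      using pos u0 by (simp add: divide_simps) algebra
    finally show "1 - w = 1 / (\<phi> * u\<^sup>2)" .
  qed
  \<comment> \<open>The monomial forms also place \<open>u\<close>, \<open>v\<close> and
    \<open>w\<close> in the open unit interval, as the functional equations require.\<close>
  have gt0: "v > 0" "w > 0" "1 - u > 0" "1 - v > 0" "1 - w > 0"
    using pos u0 unfolding compl by (auto simp: v_def w_def)
  have w: "(sqrt (\<phi> ^ 7 + 3 * \<phi> ^ 5) - \<phi> ^ 2 - 3 * \<phi>) / 2 = w"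
  proof -
    \<comment> \<open>Since \<open>1 / \<phi> = \<phi> - 1\<close>, the factor
      \<open>\<phi> + 3 / \<phi>\<close> left after extracting \<open>\<phi> ^ 6\<close> is
      \<open>4 * \<phi> - 3\<close>.\<close>
    have "\<phi> ^ 7 + 3 * \<phi> ^ 5 = (\<phi> ^ 3 * s)\<^sup>2"
      using sq s(1) by algebra
    then have "sqrt (\<phi> ^ 7 + 3 * \<phi> ^ 5) = \<phi> ^ 3 * s"
      using pos s(2) by (simp add: real_sqrt_abs)
    moreover have "(\<phi> ^ 3 * s - \<phi> ^ 2 - 3 * \<phi>) * (\<phi> ^ 4 * u ^ 3) = 2"
      using sq us u_eq by algebra
    ultimately show ?thesis
      using pos u0 by (simp add: w_def eq_divide_eq)
  qed
  \<comment> \<open>By \<open>compl\<close>, the two logarithm arguments are the reciprocals of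
    \<open>1 - v\<close> and \<open>1 - w\<close>.\<close>
  have l1: "(\<phi> ^ 2 + 1 + sqrt (4 * \<phi> ^ 3 - 3 * \<phi> ^ 2)) / 2 = \<phi> ^ 3 * u\<^sup>2"
  proof -
    have "4 * \<phi> ^ 3 - 3 * \<phi> ^ 2 = (\<phi> * s)\<^sup>2"
      using s(1) by algebra
    then have "sqrt (4 * \<phi> ^ 3 - 3 * \<phi> ^ 2) = \<phi> * s"
      using pos s(2) by (simp add: real_sqrt_abs)
    moreover have "\<phi> ^ 2 + 1 + \<phi> * s = 2 * (\<phi> ^ 3 * u\<^sup>2)"
      using sq us u_eq by algebra
    ultimately show ?thesis
      by simp
  qed
  have l2: "(2 * \<phi> - 1 + s) / (2 * \<phi>) = \<phi> * u\<^sup>2"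
  proof -
    have "2 * \<phi> - 1 + s = \<phi> * u\<^sup>2 * (2 * \<phi>)"
      using sq us s(1) by algebra
    then show ?thesis
      using pos by simp
  qed
  \<comment> \<open>Every logarithm that occurs is an integer combination of \<open>p\<close> and
    \<open>q\<close>, so the logarithmic part reduces to a quadratic polynomial identity.\<close>
  define p q where "p = ln \<phi>" and "q = ln u"
  have ln_w: "ln w = - 4 * p - 3 * q" and ln_v: "ln v = - p - q"
    and ln_1w: "ln (1 - w) = - p - 2 * q" and ln_1v: "ln (1 - v) = - 3 * p - 2 * q"
    and ln_1u: "ln (1 - u) = - 5 * p - 2 * q"
    using pos u0 unfolding compl
    by (simp_all add: v_def w_def p_def q_def ln_div ln_mult ln_realpow)
  have xy: "(1 - w) * u = v"
    using pos u0 unfolding compl v_def by (simp add: field_simps power2_eq_square)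
  have a: "(1 - w) * (1 - u) / (1 - v) = 1 - v"
    using pos u0 unfolding compl by (simp add: field_simps) algebra
  have b: "u * w / (1 - v) = 1 / \<phi>"
    using pos u0 unfolding compl w_def by (simp add: field_simps) algebra
  have "Li2 (1 - w) + Li2 u - Li2 v - Li2 (1 - v) - Li2 (1 / \<phi>)
      = ln (w / (1 - v)) * ln ((1 - u) / (1 - v))"
    using Li2_five_term[of "1 - w" u] gt0 u0 by (simp add: xy a b)
  moreover have "Li2 w + Li2 (1 - w) = pi\<^sup>2 / 6 - ln w * ln (1 - w)"
    using gt0 by (intro Li2_reflection) auto
  moreover have "Li2 v + Li2 (1 - v) = pi\<^sup>2 / 6 - ln v * ln (1 - v)"
    using gt0 by (intro Li2_reflection) auto
  moreover have "Li2 (1 / \<phi>) = pi\<^sup>2 / 10 - p\<^sup>2"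
    using Li2_golden[OF assms] by (simp add: p_def)
  moreover have "ln (\<phi> ^ 3 * u\<^sup>2) = 3 * p + 2 * q" "ln (\<phi> * u\<^sup>2) = p + 2 * q"
    using pos u0 by (simp_all add: p_def q_def ln_mult ln_realpow)
  moreover have "ln (w / (1 - v)) = ln w - ln (1 - v)" "ln ((1 - u) / (1 - v)) = ln (1 - u) - ln (1 - v)"
    using gt0 by (simp_all add: ln_div)
  \<comment> \<open>The reflection constants cancel. What remains is \<open>- (4*p + 3*q) * (p +
    2*q) + (p + q) * (3*p + 2*q) - 2*p * (p + q) = - (3*p + 2*q) * (p + 2*q)\<close>.\<close>
  ultimately have "Li2 w - Li2 u = - (pi\<^sup>2 / 10) + p\<^sup>2 - ln (\<phi> ^ 3 * u\<^sup>2) * ln (\<phi> * u\<^sup>2)"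
    unfolding ln_w ln_v ln_1w ln_1v ln_1u by (simp add: algebra_simps power2_eq_square)
  then show ?thesis
    unfolding w l1 p_def l2[unfolded s_def] u_def s_def .
qed

end
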